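(* Let $X$ and $Y$ be distributive lattices and assume that $Y$ is conditionally complete and satisfies the dual to the infinite distributive law, that is, $$y\vee\inf S=\inf\{y\vee s\colon s\in S\}$$ for every $y\in Y$ and every nonempty $S\subset Y$ bounded from below. Assume that maps $f\colon X\to Y$ and $\phi,\psi\colon X\times X\to Y$ satisfy the following conditions: $$\phi(z,z)\leq\phi(x,y)\quad\text{for all }x,y,z\in X\text{ with }x\leq z\text{ and }y\leq z,$$ $$\psi(x,y)\leq\psi(z,z)\quad\text{for all }x,y,z\in X\text{ with }x\leq z\text{ and }y\leq z,$$ and $$\phi(x,y)\wedge f(x\vee y)\leq f(x)\vee f(y)\leq f(x\vee y)\vee \psi(x,y)\quad\text{for all }x,y\in X.$$ Then there exists a join homomorphism $F\colon X\to Y$ such that $$\phi(x,x)\wedge f(x)\leq F(x)\leq f(x)\vee \psi(x,x)\quad\text{for all }x\in X.$$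
   Context: A lattice is called conditionally complete if every nonempty bounded subset of it admits a least upper bound and a greatest lower bound. A map $F\colon X\to Y$ between lattices is called a join homomorphism if $F(x\vee y)=F(x)\vee F(y)$ for all $x,y\in X$. *)

theory Defs
  imports Main
begin

definition join_homomorphism :: "('a::lattice \<Rightarrow> 'b::lattice) \<Rightarrow> bool" where
  "join_homomorphism F \<longleftrightarrow> (\<forall>x y. F (sup x y) = sup (F x) (F y))"

end

(* The maps h x = inf (phi (x, x)) (f x) and g x = sup (f x) (psi (x, x)) satisfy h \<le> g, h is
   join-subadditive and g is monotone. The value F x is the infimum of all sup (g x1) ... (g xn)
   over decompositions x = sup x1 ... xn. Subadditivity of h bounds F from below; distributivity
   of X lets a decomposition of z be cut down to one of any x \<le> z, so F is monotone; the dual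
   infinite distributive law in Y makes F join-subadditive. *)
theory Submission
  imports Defs
begin

text \<open>The pairs (\<open>sup x1 \<dots> xn\<close>, \<open>sup (g x1) \<dots> (g xn)\<close>), i.e. the
  subsemilattice of the product generated by the graph of \<open>g\<close>.\<close>

inductive join_cover :: "('a::lattice \<Rightarrow> 'b::lattice) \<Rightarrow> 'a \<Rightarrow> 'b \<Rightarrow> bool"
  for g where
  base: "join_cover g x (g x)"
| join: "join_cover g x a \<Longrightarrow> join_cover g y b \<Longrightarrow> join_cover g (sup x y) (sup a b)"

text \<open>Subadditivity carries the bound \<open>h \<le> g\<close> from the generators to all
  joins. This also bounds the covers of \<open>x\<close> below, as conditional completeness
  requires.\<close>

lemma join_cover_ge:
  assumes "join_cover g x c"
    and "\<And>x. h x \<le> g x"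
    and "\<And>x y. h (sup x y) \<le> sup (h x) (h y)"
  shows "h x \<le> c"
  using assms(1)
proof induction
  case (base x)
  then show ?case by (rule assms(2))
next
  case (join x a y b)
  then show ?case using assms(3)[of x y] by (meson order_trans sup_mono)
qed

text \<open>At a generator, monotonicity replaces \<open>g z\<close> by \<open>g x\<close>. At a
  join, \<open>inf x z1\<close> and \<open>inf x z2\<close> are covered separately and rejoin to
  \<open>x\<close>.\<close>

lemma join_cover_restrict:
  fixes g :: "'a::distrib_lattice \<Rightarrow> 'b::lattice"
  assumes "join_cover g z c" and "mono g" and "x \<le> z"
  shows "\<exists>c'\<le>c. join_cover g x c'"
  using assms(1,3)
proof (induction arbitrary: x)
  case (base z)
  then show ?case using \<open>mono g\<close> join_cover.base monoD by blast
next
  case (join z1 a z2 b)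
  obtain a' b' where "a' \<le> a" "join_cover g (inf x z1) a'" "b' \<le> b" "join_cover g (inf x z2) b'"
    using join.IH by (meson inf_le2)
  moreover have "sup (inf x z1) (inf x z2) = x"
    using join.prems by (simp add: inf_sup_distrib1[symmetric] inf_absorb1)
  ultimately show ?case using join_cover.join by (metis sup_mono)
qed

text \<open>The \<open>F\<close> constructed is the largest join-subadditive map below
  \<open>g\<close>, since \<open>join_cover_ge\<close> applies to any such map in place of
  \<open>h\<close>.\<close>

lemma join_homomorphism_sandwich:
  fixes g h :: "'a::distrib_lattice \<Rightarrow> 'b::conditionally_complete_lattice"
  assumes dual_inf_distrib:
      "\<And>(y::'b) S. S \<noteq> {} \<Longrightarrow> bdd_below S \<Longrightarrow> sup y (Inf S) = Inf {sup y s | s. s \<in> S}"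
    and "mono g"
    and le: "\<And>x. h x \<le> g x"
    and sub: "\<And>x y. h (sup x y) \<le> sup (h x) (h y)"
  shows "\<exists>F. join_homomorphism F \<and> (\<forall>x. h x \<le> F x \<and> F x \<le> g x)"
proof -
  define C where "C x = {c. join_cover g x c}" for x
  define F where "F x = Inf (C x)" for x
  have ne: "C x \<noteq> {}" for x using join_cover.base by (auto simp: C_def)
  have bdd: "bdd_below (C x)" for x
    using join_cover_ge[OF _ le sub] by (auto simp: C_def intro!: bdd_belowI)
  have F_le: "F x \<le> c" if "join_cover g x c" for x c
    using that bdd by (auto simp: F_def C_def intro: cInf_lower)
  have le_F: "c \<le> F x" if "\<And>d. join_cover g x d \<Longrightarrow> c \<le> d" for x c
    unfolding F_def using that ne by (auto simp: C_def intro!: cInf_greatest)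
  have le_sup_F: "c \<le> sup y (F x)" if "\<And>d. join_cover g x d \<Longrightarrow> c \<le> sup y d" for c x y
  proof -
    have "sup y (F x) = Inf {sup y s | s. s \<in> C x}"
      unfolding F_def using ne bdd by (rule dual_inf_distrib)
    moreover have "c \<le> Inf {sup y s | s. s \<in> C x}"
      using ne that by (intro cInf_greatest) (auto simp: C_def)
    ultimately show ?thesis by simp
  qed
  have mono: "F x \<le> F z" if "x \<le> z" for x z
    using join_cover_restrict[OF _ \<open>mono g\<close> that] F_le by (meson le_F order_trans)
  have "F (sup x y) \<le> sup (F x) (F y)" for x y
  \<comment> \<open>The two infima are unfolded one at a time: first over covers of \<open>y\<close>
    with \<open>F x\<close> fixed, then over covers of \<open>x\<close> with \<open>d\<close>
    fixed.\<close>
  proof (rule le_sup_F)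
    fix d assume d: "join_cover g y d"
    have "F (sup x y) \<le> sup d (F x)"
    proof (rule le_sup_F)
      fix c assume "join_cover g x c"
      then show "F (sup x y) \<le> sup d c"
        using d F_le[OF join_cover.join] by (metis sup.commute)
    qed
    then show "F (sup x y) \<le> sup (F x) d" by (simp add: sup.commute)
  qed
  moreover have "sup (F x) (F y) \<le> F (sup x y)" for x y
    by (simp add: mono)
  ultimately have "join_homomorphism F"
    by (simp add: join_homomorphism_def order.antisym)
  moreover have "h x \<le> F x \<and> F x \<le> g x" for x
    using join_cover_ge[OF _ le sub] le_F F_le join_cover.base by metis
  ultimately show ?thesis by blast
qed

theorem theorem7:
  fixes f :: "'a::distrib_lattice \<Rightarrow> 'b::{conditionally_complete_lattice, distrib_lattice}"
    and \<phi> \<psi> :: "'a \<times> 'a \<Rightarrow> 'b"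
  assumes dual_inf_distrib:
      "\<And>(y::'b) S. S \<noteq> {} \<Longrightarrow> bdd_below S \<Longrightarrow> sup y (Inf S) = Inf {sup y s | s. s \<in> S}"
    and phi: "\<And>x y z. x \<le> z \<Longrightarrow> y \<le> z \<Longrightarrow> \<phi> (z, z) \<le> \<phi> (x, y)"
    and psi: "\<And>x y z. x \<le> z \<Longrightarrow> y \<le> z \<Longrightarrow> \<psi> (x, y) \<le> \<psi> (z, z)"
    and lower: "\<And>x y. inf (\<phi> (x, y)) (f (sup x y)) \<le> sup (f x) (f y)"
    and upper: "\<And>x y. sup (f x) (f y) \<le> sup (f (sup x y)) (\<psi> (x, y))"
  shows "\<exists>F :: 'a \<Rightarrow> 'b. join_homomorphism F \<and>
    (\<forall>x. inf (\<phi> (x, x)) (f x) \<le> F x \<and> F x \<le> sup (f x) (\<psi> (x, x)))"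
proof (rule join_homomorphism_sandwich[OF dual_inf_distrib])
  show "mono (\<lambda>x. sup (f x) (\<psi> (x, x)))"
  proof (rule monoI)
    fix x z :: 'a assume "x \<le> z"
    \<comment> \<open>Here \<open>sup x z = z\<close>, so \<open>upper\<close> bounds
      \<open>f x\<close> by data at \<open>z\<close> and \<open>\<psi> (x, z)\<close>.\<close>
    then have "sup (f x) (f z) \<le> sup (f z) (\<psi> (x, z))"
      using upper[of x z] by (simp add: sup_absorb2)
    also have "\<dots> \<le> sup (f z) (\<psi> (z, z))"
      using psi[OF \<open>x \<le> z\<close> order.refl] by (simp add: le_supI2)
    finally show "sup (f x) (\<psi> (x, x)) \<le> sup (f z) (\<psi> (z, z))"
      using psi[OF \<open>x \<le> z\<close> \<open>x \<le> z\<close>] by (simp add: le_supI2)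
  qed
  show "inf (\<phi> (x, x)) (f x) \<le> sup (f x) (\<psi> (x, x))" for x
    by (simp add: le_infI2)
  show "inf (\<phi> (sup x y, sup x y)) (f (sup x y))
      \<le> sup (inf (\<phi> (x, x)) (f x)) (inf (\<phi> (y, y)) (f y))" (is "inf ?p _ \<le> _") for x y
  proof -
    have "inf ?p (f (sup x y)) \<le> inf (\<phi> (x, y)) (f (sup x y))"
      using phi[of x "sup x y" y] by (simp add: le_infI1)
    also have "\<dots> \<le> sup (f x) (f y)" by (rule lower)
    \<comment> \<open>Keeping the factor \<open>?p\<close> lets distributivity of the codomain put a
      copy on each summand, where \<open>phi\<close> raises it to the diagonal value at
      \<open>x\<close> or \<open>y\<close>.\<close>
    finally have "inf ?p (f (sup x y)) \<le> inf ?p (sup (f x) (f y))" by simp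
    also have "\<dots> = sup (inf ?p (f x)) (inf ?p (f y))" by (rule inf_sup_distrib1)
    also have "\<dots> \<le> sup (inf (\<phi> (x, x)) (f x)) (inf (\<phi> (y, y)) (f y))"
      using phi[of x "sup x y" x] phi[of y "sup x y" y] by (intro sup_mono inf_mono) auto
    finally show ?thesis .
  qed
qed

end
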